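(* Let $A$ be a finite subset of $\mathbb{C}$ and let $\mathcal{P}$ be a convex relatively prime two-dimensional pattern. Let $\mathbf{w}:\mathbb{Z}^2\to A$ be a two-dimensional word such that, for some $C\in\mathbb{C}$, $\sum_{x\in F}\mathbf{w}(x)=C$ for each $F\in\mathcal{P}$. Then $\mathbf{w}$ is fully periodic.
   Context: A figure is a finite subset of $\mathbb{Z}^2$; a pattern is the set of all integer translates of a fixed figure. A figure $F$ is convex if $F=\mathrm{conv}_{\mathbb{R}^2}(F)\cap\mathbb{Z}^2$; a pattern is convex if its figures are. For a nonzero $u\in\mathbb{Z}^2$, $\mathcal{P}$ is $u$-relatively prime if the gcd of $|L\cap F|$ over all lines $L$ parallel to $u$ meeting a figure $F\in\mathcal{P}$ equals $1$; $\mathcal{P}$ is relatively prime if it is $u$-relatively prime for all nonzero $u\in\mathbb{Z}^2$. A word $\mathbf{w}$ is fully periodic if there exist two linearly independent vectors $p\in\mathbb{Z}^2$ with $\mathbf{w}(x+p)=\mathbf{w}(x)$ for all $x\in\mathbb{Z}^2$. *)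

theory Defs
  imports "HOL-Analysis.Analysis"
begin

definition plane_point :: "int \<times> int \<Rightarrow> real \<times> real" where
  "plane_point x = (real_of_int (fst x), real_of_int (snd x))"

definition is_pattern :: "(int \<times> int) set set \<Rightarrow> bool" where
  "is_pattern P \<longleftrightarrow> (\<exists>F. finite F \<and> P = {(+) v ` F | v. True})"

definition convex_figure :: "(int \<times> int) set \<Rightarrow> bool" where
  "convex_figure F \<longleftrightarrow> F = {x. plane_point x \<in> convex hull (plane_point ` F)}"

definition convex_pattern :: "(int \<times> int) set set \<Rightarrow> bool" where
  "convex_pattern P \<longleftrightarrow> (\<forall>F\<in>P. convex_figure F)"

definition line_parallel_to :: "int \<times> int \<Rightarrow> (real \<times> real) set \<Rightarrow> bool" where
  "line_parallel_to u L \<longleftrightarrow> (\<exists>a. L = {a + t *\<^sub>R plane_point u | t. True})"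

(* No line meets the empty figure, so for its pattern the gcd is Gcd {} = 0 and
   it is not relatively prime. *)
definition u_relatively_prime :: "int \<times> int \<Rightarrow> (int \<times> int) set set \<Rightarrow> bool" where
  "u_relatively_prime u P \<longleftrightarrow>
     Gcd {card (L \<inter> plane_point ` F) | L F.
            F \<in> P \<and> line_parallel_to u L \<and> L \<inter> plane_point ` F \<noteq> {}} = 1"

definition relatively_prime_pattern :: "(int \<times> int) set set \<Rightarrow> bool" where
  "relatively_prime_pattern P \<longleftrightarrow> (\<forall>u. u \<noteq> 0 \<longrightarrow> u_relatively_prime u P)"

(* The condition p \<noteq> q is needed because the set {p, q} collapses when p = q. *)
definition fully_periodic :: "(int \<times> int \<Rightarrow> 'a) \<Rightarrow> bool" where
  "fully_periodic w \<longleftrightarrow>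
     (\<exists>p q. p \<noteq> q \<and> independent {plane_point p, plane_point q} \<and>
            (\<forall>x. w (x + p) = w x) \<and> (\<forall>x. w (x + q) = w x))"

end

theory Submission
  imports Defs "HOL-Library.Poly_Mapping" "HOL-Computational_Algebra.Fundamental_Theorem_Algebra"
begin

text \<open>
  Subtract from \<open>w\<close> the constant \<open>C / |F|\<close>, so that the sum over every translate of the figure
  vanishes, and regard functions on the lattice as a module over the complex group ring, with
  \<open>T v\<close> the translation by \<open>v\<close> and \<open>f\<close> the sum of the \<open>T v\<close> over the figure. For a prime \<open>p\<close> the
  element \<open>f ^ p\<close> is congruent modulo \<open>p\<close> to the sum of the \<open>T (p v)\<close>. As \<open>w\<close> takes finitely many
  values, this dilated sum annihilates \<open>w\<close> for all large \<open>p\<close>, and hence the \<open>n\<close>-fold dilation does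
  for all \<open>n = 1 + r j\<close>. If the figure contains the origin, averaging over \<open>j\<close> writes \<open>w\<close> as a sum
  of functions with periods \<open>r v\<close>, so that the product of all \<open>T (r v) - 1\<close> annihilates \<open>w\<close>.

  It therefore suffices to study functions killed by \<open>f\<close> and by one factor \<open>T u - z\<close> with \<open>u\<close>
  primitive. By convexity every row of the figure parallel to \<open>u\<close> is an interval, so it contributes
  a power of \<open>z\<close> times \<open>1 + z + \<dots> + z ^ (n - 1)\<close>. As the row lengths \<open>n\<close> have gcd 1, some row
  contributes a nonzero coefficient, and \<open>f\<close> becomes a nonzero polynomial in a translation
  transversal to \<open>u\<close>. So \<open>w\<close> satisfies a linear recurrence in every direction, and a finite-valued
  solution of a linear recurrence is periodic.
\<close>

section \<open>The group ring acting on functions\<close>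

text \<open>The finitely supported maps with convolution are the group ring;
  \<open>single v 1\<close> acts as the translation \<open>T v\<close>, sending \<open>c\<close> to
  its shift by \<open>v\<close>.\<close>

definition act :: "('g::ab_group_add \<Rightarrow>\<^sub>0 complex) \<Rightarrow> ('g \<Rightarrow> complex) \<Rightarrow> 'g \<Rightarrow> complex" where
  "act f c x = (\<Sum>v\<in>Poly_Mapping.keys f. Poly_Mapping.lookup f v * c (x + v))"

lemma act_superset:
  assumes "finite S" "Poly_Mapping.keys f \<subseteq> S"
  shows "act f c x = (\<Sum>v\<in>S. Poly_Mapping.lookup f v * c (x + v))"
  unfolding act_def by (rule sum.mono_neutral_left) (use assms in \<open>auto simp: in_keys_iff\<close>)

lemma act_single [simp]: "act (Poly_Mapping.single v a) c x = a * c (x + v)"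
  by (subst act_superset[of "{v}"]) auto

lemma act_zero [simp]: "act 0 c = (\<lambda>_. 0)"
  by (auto simp: act_def)

lemma act_one [simp]: "act 1 c = c"
  by (auto simp flip: single_one)

lemma act_add: "act (f + g) c x = act f c x + act g c x"
proof -
  let ?S = "Poly_Mapping.keys f \<union> Poly_Mapping.keys g"
  have "act (f + g) c x = (\<Sum>v\<in>?S. Poly_Mapping.lookup (f + g) v * c (x + v))"
    by (rule act_superset) (use keys_add[of f g] in auto)
  also have "\<dots> = (\<Sum>v\<in>?S. Poly_Mapping.lookup f v * c (x + v)) + (\<Sum>v\<in>?S. Poly_Mapping.lookup g v * c (x + v))"
    by (simp add: lookup_add distrib_right sum.distrib)
  also have "(\<Sum>v\<in>?S. Poly_Mapping.lookup f v * c (x + v)) = act f c x"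
    by (rule act_superset[symmetric]) auto
  also have "(\<Sum>v\<in>?S. Poly_Mapping.lookup g v * c (x + v)) = act g c x"
    by (rule act_superset[symmetric]) auto
  finally show ?thesis .
qed

lemma act_uminus: "act (- f) c x = - act f c x"
  using act_add[of f "- f" c x] by (simp add: eq_neg_iff_add_eq_0 add.commute)

lemma act_diff: "act (f - g) c x = act f c x - act g c x"
  using act_add[of f "- g" c x] by (simp add: act_uminus)

lemma act_sum: "act (\<Sum>i\<in>I. f i) c x = (\<Sum>i\<in>I. act (f i) c x)"
  by (induction I rule: infinite_finite_induct) (auto simp: act_add)

lemma sum_single_lookup: "(\<Sum>v\<in>Poly_Mapping.keys f. Poly_Mapping.single v (Poly_Mapping.lookup f v)) = f"
proof (rule poly_mapping_eqI)
  fix k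
  show "Poly_Mapping.lookup (\<Sum>v\<in>Poly_Mapping.keys f. Poly_Mapping.single v (Poly_Mapping.lookup f v)) k = Poly_Mapping.lookup f k"
    by (simp add: lookup_sum lookup_single when_def in_keys_iff)
qed

text \<open>Expanding both factors into monomials reduces this to associativity of addition; it
  makes functions a module over the group ring.\<close>

lemma act_mult: "act (f * g) c = act f (act g c)"
proof
  fix x
  have *: "act (Poly_Mapping.single v a * g) c x = a * act g c (x + v)" for v a x
  proof -
    have "act (Poly_Mapping.single v a * (\<Sum>u\<in>Poly_Mapping.keys g. Poly_Mapping.single u (Poly_Mapping.lookup g u))) c x
        = (\<Sum>u\<in>Poly_Mapping.keys g. a * (Poly_Mapping.lookup g u * c (x + v + u)))"
      by (simp add: sum_distrib_left act_sum mult_single ac_simps)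
    also have "\<dots> = a * act g c (x + v)"
      by (simp add: act_def sum_distrib_left)
    finally show ?thesis by (simp add: sum_single_lookup)
  qed
  have "act ((\<Sum>v\<in>Poly_Mapping.keys f. Poly_Mapping.single v (Poly_Mapping.lookup f v)) * g) c x
      = (\<Sum>v\<in>Poly_Mapping.keys f. Poly_Mapping.lookup f v * act g c (x + v))"
    by (simp add: sum_distrib_right act_sum *)
  then show "act (f * g) c x = act f (act g c) x"
    by (simp add: sum_single_lookup act_def[of f "act g c"])
qed

definition annihilates :: "('g::ab_group_add \<Rightarrow>\<^sub>0 complex) \<Rightarrow> ('g \<Rightarrow> complex) \<Rightarrow> bool" where
  "annihilates f c \<longleftrightarrow> act f c = (\<lambda>_. 0)"

lemma act_null [simp]: "act f (\<lambda>_. 0) = (\<lambda>_. 0)"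
  by (auto simp: act_def)

lemma annihilates_mult_iff: "annihilates (f * g) c \<longleftrightarrow> annihilates f (act g c)"
  by (simp add: annihilates_def act_mult)

lemma annihilates_mult: "annihilates f c \<Longrightarrow> annihilates (g * f) c"
  by (simp add: annihilates_def act_mult)

lemma annihilates_act: "annihilates f c \<Longrightarrow> annihilates f (act g c)"
  using annihilates_mult[of f c g] by (simp only: mult.commute[of g] annihilates_mult_iff)

lemma annihilates_dvd: "annihilates f c \<Longrightarrow> f dvd g \<Longrightarrow> annihilates g c"
  by (elim dvdE) (simp only: mult.commute[of f] annihilates_mult)

section \<open>Polynomials in a single translation\<close>

definition zscale :: "int \<Rightarrow> int \<times> int \<Rightarrow> int \<times> int" where
  "zscale n v = (n * fst v, n * snd v)"

lemma zscale_simps [simp]: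
  "zscale 0 v = 0" "zscale 1 v = v" "zscale n 0 = 0" "fst (zscale n v) = n * fst v" "snd (zscale n v) = n * snd v"
  by (auto simp: zscale_def zero_prod_def)

lemma zscale_add_left: "zscale (m + n) v = zscale m v + zscale n v"
  by (auto simp: zscale_def algebra_simps)

lemma zscale_diff_left: "zscale (m - n) v = zscale m v - zscale n v"
  by (auto simp: zscale_def algebra_simps)

lemma zscale_zscale [simp]: "zscale m (zscale n v) = zscale (m * n) v"
  by (auto simp: zscale_def)

lemma zscale_eq_0_iff [simp]: "zscale n v = 0 \<longleftrightarrow> n = 0 \<or> v = 0"
  by (auto simp: zscale_def zero_prod_def prod_eq_iff)

type_synonym grp_ring = "(int \<times> int) \<Rightarrow>\<^sub>0 complex"

definition poly_at :: "int \<times> int \<Rightarrow> complex poly \<Rightarrow> grp_ring" where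
  "poly_at e p = (\<Sum>i\<le>degree p. Poly_Mapping.single (zscale (int i) e) (coeff p i))"

lemma poly_at_superset:
  assumes "degree p \<le> n"
  shows "poly_at e p = (\<Sum>i\<le>n. Poly_Mapping.single (zscale (int i) e) (coeff p i))"
  unfolding poly_at_def by (rule sum.mono_neutral_left) (use assms in \<open>auto simp: coeff_eq_0\<close>)

lemma poly_at_0 [simp]: "poly_at e 0 = 0"
  by (simp add: poly_at_def)

text \<open>Horner's rule; with it, induction on polynomials shows that \<open>poly_at e\<close> is
  a ring homomorphism sending the variable to \<open>T e\<close>.\<close>

lemma poly_at_pCons: "poly_at e (pCons a p) = Poly_Mapping.single 0 a + Poly_Mapping.single e 1 * poly_at e p"
proof -
  have "poly_at e (pCons a p) = (\<Sum>i\<le>Suc (degree p). Poly_Mapping.single (zscale (int i) e) (coeff (pCons a p) i))"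
    by (rule poly_at_superset) (rule degree_pCons_le)
  also have "\<dots> = Poly_Mapping.single 0 a + (\<Sum>i\<le>degree p. Poly_Mapping.single (zscale (int (Suc i)) e) (coeff p i))"
    by (subst sum.atMost_Suc_shift) simp
  also have "(\<Sum>i\<le>degree p. Poly_Mapping.single (zscale (int (Suc i)) e) (coeff p i)) = Poly_Mapping.single e 1 * poly_at e p"
    by (simp add: poly_at_def sum_distrib_left mult_single zscale_add_left)
  finally show ?thesis .
qed

lemma poly_at_add: "poly_at e (p + q) = poly_at e p + poly_at e q"
  by (induction p q rule: poly_induct2) (auto simp: poly_at_pCons single_add algebra_simps)

lemma poly_at_sum: "poly_at e (\<Sum>i\<in>I. p i) = (\<Sum>i\<in>I. poly_at e (p i))"
  by (induction I rule: infinite_finite_induct) (auto simp: poly_at_add)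

lemma poly_at_smult: "poly_at e (smult a p) = Poly_Mapping.single 0 a * poly_at e p"
  by (induction p) (auto simp: poly_at_pCons mult_single algebra_simps)

lemma poly_at_mult: "poly_at e (p * q) = poly_at e p * poly_at e q"
  by (induction p) (auto simp: poly_at_pCons poly_at_add poly_at_smult algebra_simps)

lemma poly_at_1 [simp]: "poly_at e 1 = 1"
  by (simp add: poly_at_def)

lemma poly_at_monom: "poly_at e (monom a n) = Poly_Mapping.single (zscale (int n) e) a"
proof -
  have "poly_at e (monom a n) = (\<Sum>i\<le>n. Poly_Mapping.single (zscale (int i) e) (coeff (monom a n) i))"
    by (rule poly_at_superset) (rule degree_monom_le)
  also have "\<dots> = (\<Sum>i\<in>{n}. Poly_Mapping.single (zscale (int i) e) (coeff (monom a n) i))"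
    by (rule sum.mono_neutral_right) auto
  finally show ?thesis by simp
qed

lemma poly_at_linear: "poly_at e [:- a, 1:] = Poly_Mapping.single e 1 - Poly_Mapping.single 0 a"
  by (simp add: poly_at_pCons single_uminus)

section \<open>Linear recurrences along a direction\<close>

definition recurrent_along :: "int \<times> int \<Rightarrow> (int \<times> int \<Rightarrow> complex) \<Rightarrow> bool" where
  "recurrent_along e c \<longleftrightarrow> (\<exists>p. p \<noteq> 0 \<and> annihilates (poly_at e p) c)"

text \<open>The two recurrence polynomials multiply to a nonzero one, since complex polynomials have
  no zero divisors.\<close>

lemma recurrent_along_act:
  assumes "recurrent_along e (act (poly_at e p) c)" "p \<noteq> 0"
  shows "recurrent_along e c"
proof -
  from assms obtain q where "q \<noteq> 0" "annihilates (poly_at e q) (act (poly_at e p) c)" by (auto simp: recurrent_along_def)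
  then have "q * p \<noteq> 0" "annihilates (poly_at e (q * p)) c"
    using assms(2) by (simp_all add: annihilates_mult_iff poly_at_mult)
  then show ?thesis unfolding recurrent_along_def by blast
qed

text \<open>
  Closed under products in \<open>g\<close>, so only the linear factors of an annihilator need treatment.
\<close>

definition forces :: "grp_ring set \<Rightarrow> int \<times> int \<Rightarrow> grp_ring \<Rightarrow> bool" where
  "forces I e g \<longleftrightarrow> (\<forall>c. (\<forall>f\<in>I. annihilates f c) \<longrightarrow> annihilates g c \<longrightarrow> recurrent_along e c)"

text \<open>A recurrence \<open>p\<close> for \<open>act h c\<close> says that \<open>h\<close>
  kills \<open>act (poly_at e p) c\<close>. That function is still annihilated by \<open>I\<close>,
  so it has a recurrence of its own.\<close>

lemma forces_mult:
  assumes "forces I e g" "forces I e h"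
  shows "forces I e (g * h)"
  unfolding forces_def
proof (intro allI impI)
  fix c assume I: "\<forall>f\<in>I. annihilates f c" and k: "annihilates (g * h) c"
  from k have "annihilates g (act h c)" by (simp add: annihilates_mult_iff)
  then have "recurrent_along e (act h c)" using assms(1) I unfolding forces_def by (blast intro: annihilates_act)
  then obtain p where p: "p \<noteq> 0" "annihilates (poly_at e p) (act h c)" by (auto simp: recurrent_along_def)
  then have "annihilates h (act (poly_at e p) c)" by (simp only: annihilates_mult_iff[symmetric] mult.commute)
  then have "recurrent_along e (act (poly_at e p) c)" using assms(2) I unfolding forces_def by (blast intro: annihilates_act)
  then show "recurrent_along e c" using p(1) by (rule recurrent_along_act)
qed

lemma forces_unit: "a \<noteq> 0 \<Longrightarrow> forces I e (Poly_Mapping.single 0 a)"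
  unfolding forces_def recurrent_along_def by (intro allI impI exI[of _ 1]) (auto simp: annihilates_def fun_eq_iff)

lemma forces_prod:
  assumes "\<And>i. i \<in> S \<Longrightarrow> forces I e (g i)"
  shows "forces I e (\<Prod>i\<in>S. g i)"
  using assms
  by (induction S rule: infinite_finite_induct)
     (auto intro: forces_mult forces_unit[of 1, simplified])

text \<open>Over the complex numbers \<open>q\<close> splits into linear factors, so only
  eigenfunctions of \<open>T u\<close> at roots of \<open>q\<close> remain.\<close>

lemma forces_poly_at:
  assumes lin: "\<And>a. poly q a = 0 \<Longrightarrow> forces I e (Poly_Mapping.single u 1 - Poly_Mapping.single 0 a)" and "q \<noteq> 0"
  shows "forces I e (poly_at u q)"
  using assms
proof (induction "degree q" arbitrary: q)
  case 0
  then obtain a where "q = [:a:]" by (metis degree_eq_zeroE)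
  with 0 show ?case by (simp add: poly_at_pCons forces_unit)
next
  case (Suc n)
  then obtain a where a: "poly q a = 0"
    using fundamental_theorem_of_algebra constant_degree by (metis nat.distinct(1))
  then obtain r where q: "q = [:- a, 1:] * r" by (auto simp: poly_eq_0_iff_dvd dvd_def)
  then have r: "r \<noteq> 0" using Suc by auto
  have "degree q = Suc (degree r)" using r unfolding q by (subst degree_mult_eq) auto
  then have "forces I e (poly_at u r)" using Suc q r by (intro Suc.hyps(1)) auto
  then have "forces I e ((Poly_Mapping.single u 1 - Poly_Mapping.single 0 a) * poly_at u r)"
    by (intro forces_mult Suc.prems(1)[OF a])
  then show ?case unfolding q poly_at_mult poly_at_linear .
qed

lemma annihilates_shift_iff:
  "annihilates (Poly_Mapping.single u 1 - Poly_Mapping.single 0 a) c \<longleftrightarrow> (\<forall>x. c (x + u) = a * c x)"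
  by (auto simp: annihilates_def fun_eq_iff act_diff)

lemma eigen_nonzero:
  fixes c :: "'g::ab_group_add \<Rightarrow> complex"
  assumes "\<And>x. c (x + u) = a * c x" "c y \<noteq> 0"
  shows "a \<noteq> 0"
  using assms(1)[of "y - u"] assms(2) by auto

lemma eigen_powi:
  fixes c :: "int \<times> int \<Rightarrow> complex"
  assumes eig: "\<And>x. c (x + u) = a * c x" and a: "a \<noteq> 0"
  shows "c (x + zscale n u) = a powi n * c x"
proof (induction n rule: int_induct[where k = 0])
  case (step1 i)
  have "c (x + zscale (i + 1) u) = c (x + zscale i u + u)" by (simp add: zscale_add_left add.assoc)
  with step1 show ?case using a by (simp add: eig power_int_add)
next
  case (step2 i)
  have "c (x + zscale i u) = c (x + zscale (i - 1) u + u)"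
    by (simp only: zscale_diff_left zscale_simps add.assoc diff_add_cancel)
  with step2 have "a * c (x + zscale (i - 1) u) = a powi i * c x" by (simp only: eig)
  then show ?case using a by (simp add: power_int_diff field_simps)
qed auto

text \<open>A common eigenfunction of \<open>T u\<close> and \<open>T w\<close> is one of
  \<open>T e\<close> too, with eigenvalue \<open>a powi l * z powi k\<close>, so a linear polynomial
  suffices.\<close>

lemma forces_shift:
  assumes e: "e = zscale k u + zscale l w"
  shows "forces {Poly_Mapping.single u 1 - Poly_Mapping.single 0 z} e
           (Poly_Mapping.single w 1 - Poly_Mapping.single 0 a)"
  unfolding forces_def
proof (intro allI impI)
  fix c
  assume "\<forall>f\<in>{Poly_Mapping.single u 1 - Poly_Mapping.single 0 z}. annihilates f c"
    "annihilates (Poly_Mapping.single w 1 - Poly_Mapping.single 0 a) c"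
  then have u: "\<And>x. c (x + u) = z * c x" and w: "\<And>x. c (x + w) = a * c x"
    by (auto simp: annihilates_shift_iff)
  show "recurrent_along e c"
  proof (cases "c = (\<lambda>_. 0)")
    case True
    then show ?thesis unfolding recurrent_along_def by (intro exI[of _ 1]) (auto simp: annihilates_def)
  next
    case False
    then obtain y where "c y \<noteq> 0" by (metis ext)
    \<comment> \<open>Translations are invertible, so a nonzero eigenfunction has nonzero
      eigenvalues; \<open>k\<close> and \<open>l\<close> may be negative.\<close>
    then have "z \<noteq> 0" "a \<noteq> 0" using eigen_nonzero u w by metis+
    then have "c (x + e) = (a powi l * z powi k) * c x" for x
      using eigen_powi[of c w a "x + zscale k u" l] eigen_powi[of c u z x k] u w
      by (simp add: e add.assoc)
    then have "annihilates (poly_at e [:- (a powi l * z powi k), 1:]) c"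
      by (simp only: poly_at_linear annihilates_shift_iff) simp
    then show ?thesis unfolding recurrent_along_def by (intro exI conjI) auto
  qed
qed

section \<open>Rows of convex figures\<close>

definition figure_op :: "(int \<times> int) set \<Rightarrow> grp_ring" where
  "figure_op F = (\<Sum>v\<in>F. Poly_Mapping.single v 1)"

lemma act_figure_op: "act (figure_op F) c x = (\<Sum>v\<in>F. c (x + v))"
  by (simp add: figure_op_def act_sum)

lemma poly_at_diff: "poly_at e (p - q) = poly_at e p - poly_at e q"
  using poly_at_add[of e "p - q" q] by (simp add: eq_diff_eq)

text \<open>For \<open>z = 1\<close> the sums are the \<open>n\<close> themselves. Otherwise each
  vanishing geometric sum gives \<open>z ^ n = 1\<close>, and the order of \<open>z\<close>, which
  exceeds 1, divides every \<open>n\<close>.\<close>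

lemma gcd_roots_of_unity:
  fixes z :: complex
  assumes "\<And>n. n \<in> S \<Longrightarrow> (\<Sum>i<n. z ^ i) = 0" and "Gcd S = 1"
  shows False
proof (cases "z = 1")
  case True
  then have "n = 0" if "n \<in> S" for n using assms(1)[OF that] by simp
  then have "Gcd S = 0" by (auto simp: Gcd_0_iff)
  with assms(2) show False by simp
next
  case False
  have z1: "z ^ n = 1" if "n \<in> S" for n
    using assms(1)[OF that] False by (simp add: geometric_sum)
  obtain n where n: "n \<in> S" "n \<noteq> 0"
    using assms(2) by (metis Gcd_0_iff empty_iff insertI1 subsetI zero_neq_one)
  define d where "d = (LEAST k. 0 < k \<and> z ^ k = 1)"
  have d: "0 < d" "z ^ d = 1"
    using LeastI[of "\<lambda>k. 0 < k \<and> z ^ k = 1" n] n z1 by (auto simp: d_def)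
  have "d dvd m" if "m \<in> S" for m
  proof (rule ccontr)
    assume "\<not> d dvd m"
    then have "0 < m mod d" by (simp add: mod_greater_zero_iff_not_dvd)
    moreover have "z ^ (m mod d) = 1"
    proof -
      have "z ^ m = (z ^ d) ^ (m div d) * z ^ (m mod d)"
        by (simp flip: power_mult power_add)
      then show ?thesis using z1[OF that] d by simp
    qed
    ultimately have "d \<le> m mod d" unfolding d_def by (intro Least_le) auto
    then show False using mod_less_divisor[OF d(1), of m] by linarith
  qed
  then have "d dvd Gcd S" by (rule Gcd_greatest)
  then show False using assms(2) d False by simp
qed

lemma finite_int_interval:
  fixes I :: "int set"
  assumes "finite I" "I \<noteq> {}" "\<And>a b i. a \<in> I \<Longrightarrow> b \<in> I \<Longrightarrow> a \<le> i \<Longrightarrow> i \<le> b \<Longrightarrow> i \<in> I"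
  shows "I = {Min I..Max I}"
proof
  show "I \<subseteq> {Min I..Max I}" using assms(1) by auto
  show "{Min I..Max I} \<subseteq> I"
    using assms(3)[OF Min_in[OF assms(1,2)] Max_in[OF assms(1,2)]] by auto
qed

lemma sum_powi_interval:
  fixes z :: complex
  assumes "z \<noteq> 0" "a \<le> b"
  shows "(\<Sum>i\<in>{a..b}. z powi i) = z powi a * (\<Sum>i<card {a..b}. z ^ i)"
proof -
  have "(\<Sum>i\<in>{a..b}. z powi i) = (\<Sum>i<card {a..b}. z powi (a + int i))"
  proof (rule sum.reindex_bij_witness[of _ "\<lambda>i. a + int i" "\<lambda>i. nat (i - a)"])
  qed (use assms in auto)
  then show ?thesis using assms by (simp add: power_int_add sum_distrib_left)
qed

section \<open>Lattice coordinates adapted to a primitive vector\<close>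

locale unimodular =
  fixes u w :: "int \<times> int"
  assumes det: "fst u * snd w - snd u * fst w = 1"
begin

text \<open>Cramer's rule in the basis \<open>u\<close>, \<open>w\<close>: \<open>row\<close> is the
  coefficient of \<open>w\<close>, constant along lines parallel to \<open>u\<close>, and
  \<open>pos\<close> is the coefficient of \<open>u\<close>.\<close>

definition row :: "int \<times> int \<Rightarrow> int" where
  "row v = fst u * snd v - snd u * fst v"

definition pos :: "int \<times> int \<Rightarrow> int" where
  "pos v = fst v * snd w - snd v * fst w"

lemma decomp: "v = zscale (pos v) u + zscale (row v) w"
proof -
  have "fst v = fst v * (fst u * snd w - snd u * fst w)" 
    "snd v = snd v * (fst u * snd w - snd u * fst w)" by (simp_all add: det)
  then show ?thesis by (simp add: prod_eq_iff pos_def row_def algebra_simps)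
qed

lemma row_sc [simp]: "row (zscale i u + zscale j w) = j"
proof -
  have "row (zscale i u + zscale j w) = j * (fst u * snd w - snd u * fst w)"
    by (simp add: row_def algebra_simps)
  then show ?thesis by (simp add: det)
qed

lemma pos_sc [simp]: "pos (zscale i u + zscale j w) = i"
proof -
  have "pos (zscale i u + zscale j w) = i * (fst u * snd w - snd u * fst w)"
    by (simp add: pos_def algebra_simps)
  then show ?thesis by (simp add: det)
qed

lemma u_nonzero: "u \<noteq> 0"
  using det by auto

text \<open>The point at position \<open>i\<close> is a real convex combination of \<open>v1\<close>
  and \<open>v2\<close>, and a convex figure contains every lattice point of its hull.\<close>

lemma row_convex:
  assumes "convex_figure F" "v1 \<in> F" "v2 \<in> F" "row v1 = j" "row v2 = j" "pos v1 \<le> i" "i \<le> pos v2"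
  shows "zscale i u + zscale j w \<in> F"
proof (cases "pos v1 = pos v2")
  case True
  then show ?thesis using assms decomp[of v1] by simp
next
  case False
  define t where "t = real_of_int (i - pos v1) / real_of_int (pos v2 - pos v1)"
  have t: "0 \<le> t" "t \<le> 1" and "t * real_of_int (pos v2 - pos v1) = real_of_int (i - pos v1)"
    using False assms(6,7) by (auto simp: t_def divide_simps)
  then have i: "real_of_int i = real_of_int (pos v1) + t * (real_of_int (pos v2) - real_of_int (pos v1))"
    by simp
  have lin: "plane_point v = (real_of_int (pos v) * fst u + real_of_int (row v) * fst w,
               real_of_int (pos v) * snd u + real_of_int (row v) * snd w)" for v
    by (subst decomp[of v]) (simp add: plane_point_def)
  have "plane_point (zscale i u + zscale j w) = (1 - t) *\<^sub>R plane_point v1 + t *\<^sub>R plane_point v2"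
    unfolding lin pos_sc row_sc assms(4,5) i by (simp add: algebra_simps)
  also have "\<dots> \<in> convex hull (plane_point ` F)"
    using t assms(2,3) by (intro convexD_alt[OF convex_convex_hull]) (auto intro: hull_inc)
  finally show ?thesis using assms(1) by (auto simp: convex_figure_def)
qed

lemma inj_plane_point: "inj plane_point"
  by (auto simp: inj_def plane_point_def)

text \<open>The lattice points on such a line form a level set of \<open>row\<close>, so the
  cardinalities in the gcd condition are row sizes.\<close>

lemma line_inter:
  assumes L: "line_parallel_to u L" and v0: "plane_point v0 \<in> L"
  shows "L \<inter> plane_point ` F = plane_point ` {v \<in> F. row v = row v0}"
proof -
  from L obtain a where La: "L = {a + t *\<^sub>R plane_point u | t. True}"
    by (auto simp: line_parallel_to_def)
  with v0 obtain t0 where t0: "plane_point v0 = a + t0 *\<^sub>R plane_point u" by auto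
  have "plane_point v \<in> L \<longleftrightarrow> row v = row v0" for v
  proof
    assume "plane_point v \<in> L"
    then obtain t where "plane_point v = a + t *\<^sub>R plane_point u" using La by auto
    with t0 have "plane_point v - plane_point v0 = (t - t0) *\<^sub>R plane_point u"
      by (simp add: algebra_simps)
    then have "real_of_int (fst v) - fst v0 = (t - t0) * fst u"
      "real_of_int (snd v) - snd v0 = (t - t0) * snd u"
      by (auto simp: plane_point_def)
    then have "real_of_int (fst u) * (real_of_int (snd v) - snd v0)
        = real_of_int (snd u) * (real_of_int (fst v) - fst v0)" by simp
    then have "real_of_int (row v) = real_of_int (row v0)" by (simp add: row_def algebra_simps)
    then show "row v = row v0" by simp
  next
    assume "row v = row v0"
    have "v - v0 = zscale (pos v) u + zscale (row v) w - (zscale (pos v0) u + zscale (row v0) w)"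
      by (rule arg_cong2[OF decomp decomp])
    then have "v = v0 + zscale (pos v - pos v0) u"
      unfolding \<open>row v = row v0\<close> by (simp add: zscale_diff_left algebra_simps)
    then have "fst v = fst v0 + (pos v - pos v0) * fst u" "snd v = snd v0 + (pos v - pos v0) * snd u"
      by (metis fst_add zscale_simps(4), metis snd_add zscale_simps(5))
    then have "plane_point v = plane_point v0 + real_of_int (pos v - pos v0) *\<^sub>R plane_point u"
      by (simp add: plane_point_def)
    then have "plane_point v = a + (t0 + real_of_int (pos v - pos v0)) *\<^sub>R plane_point u"
      by (simp add: t0 algebra_simps)
    then show "plane_point v \<in> L" unfolding La by blast
  qed
  then show ?thesis by auto
qed

text \<open>By convexity the positions in a nonempty row form an interval, so its sum is a power of
  \<open>z\<close> times \<open>1 + z + \<dots> + z ^ (n - 1)\<close>. If all row sums vanished, so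
  would the geometric sums of all row lengths, against gcd 1.\<close>

lemma nonzero_row_sum:
  fixes z :: complex
  assumes fin: "\<And>F. F \<in> P \<Longrightarrow> finite F" and conv: "convex_pattern P"
    and prim: "u_relatively_prime u P" and z: "z \<noteq> 0"
  obtains F j where "F \<in> P" "(\<Sum>v\<in>{v\<in>F. row v = j}. z powi pos v) \<noteq> 0"
proof (rule ccontr)
  assume "\<not> thesis"
  with that have zero: "F \<in> P \<Longrightarrow> (\<Sum>v\<in>{v\<in>F. row v = j}. z powi pos v) = 0" for F j by blast
  let ?S = "{card (L \<inter> plane_point ` F) | L F.
            F \<in> P \<and> line_parallel_to u L \<and> L \<inter> plane_point ` F \<noteq> {}}"
  show False
  proof (rule gcd_roots_of_unity[of ?S])
    show "Gcd ?S = 1" using prim by (simp add: u_relatively_prime_def)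
    fix n assume "n \<in> ?S"
    then obtain L F where n: "n = card (L \<inter> plane_point ` F)" and F: "F \<in> P"
      and L: "line_parallel_to u L" and ne: "L \<inter> plane_point ` F \<noteq> {}" by blast
    from ne obtain v0 where v0: "v0 \<in> F" "plane_point v0 \<in> L" by auto
    define R where "R = {v \<in> F. row v = row v0}"
    have injpos: "inj_on pos R"
      by (rule inj_onI) (metis (mono_tags, lifting) R_def decomp mem_Collect_eq)
    have "n = card R"
      using inj_plane_point by (simp add: n line_inter[OF L v0(2)] R_def card_image inj_on_def)
    also have "\<dots> = card (pos ` R)" using injpos by (simp add: card_image)
    finally have nR: "n = card (pos ` R)" .
    have "finite R" using fin[OF F] by (simp add: R_def)
    have I: "pos ` R = {Min (pos ` R)..Max (pos ` R)}"
    proof (rule finite_int_interval)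
      show "finite (pos ` R)" using \<open>finite R\<close> by simp
      show "pos ` R \<noteq> {}" using v0 unfolding R_def by blast
      fix a b i assume "a \<in> pos ` R" "b \<in> pos ` R" "a \<le> i" "i \<le> b"
      then obtain v1 v2 where "v1 \<in> R" "v2 \<in> R" "pos v1 \<le> i" "i \<le> pos v2" by auto
      moreover have "convex_figure F" using conv F by (simp add: convex_pattern_def)
      ultimately have "zscale i u + zscale (row v0) w \<in> F"
        by (intro row_convex[of F v1 v2]) (auto simp: R_def)
      then have "zscale i u + zscale (row v0) w \<in> R" by (simp add: R_def)
      then show "i \<in> pos ` R" by (metis imageI pos_sc)
    qed
    have le: "Min (pos ` R) \<le> Max (pos ` R)"
    proof -
      have "pos v0 \<in> pos ` R" using v0 by (simp add: R_def)
      then show ?thesis using \<open>finite R\<close> by (meson Max_ge Min_le finite_imageI order_trans)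
    qed
    have "0 = (\<Sum>v\<in>R. z powi pos v)" using zero[OF F] by (simp add: R_def)
    also have "\<dots> = (\<Sum>i\<in>pos ` R. z powi i)" using injpos by (simp add: sum.reindex)
    also have "\<dots> = z powi Min (pos ` R) * (\<Sum>i<n. z ^ i)"
      by (subst (1) I, subst sum_powi_interval[OF z le]) (simp only: nR I[symmetric])
    finally show "(\<Sum>i<n. z ^ i) = 0" using z by simp
  qed
qed

text \<open>Where \<open>T u\<close> acts as \<open>z\<close>, \<open>T v\<close> acts as
  \<open>z powi pos v\<close> times a power of \<open>T w\<close>. Hence the figure acts, up to a
  shift, as a polynomial in \<open>T w\<close> whose coefficients are the row sums, and for some
  figure one of them is nonzero.\<close>

lemma forces_primitive:
  assumes fin: "\<And>F. F \<in> P \<Longrightarrow> finite F" and conv: "convex_pattern P"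
    and prim: "u_relatively_prime u P"
  shows "forces (figure_op ` P) e (Poly_Mapping.single u 1 - Poly_Mapping.single 0 z)"
  unfolding forces_def
proof (intro allI impI)
  fix c
  assume kP: "\<forall>f\<in>figure_op ` P. annihilates f c"
    and ku: "annihilates (Poly_Mapping.single u 1 - Poly_Mapping.single 0 z) c"
  show "recurrent_along e c"
  proof (cases "c = (\<lambda>_. 0)")
    case True
    then show ?thesis unfolding recurrent_along_def by (intro exI[of _ 1]) (auto simp: annihilates_def)
  next
    case False
    then obtain y where y: "c y \<noteq> 0" by (metis ext)
    from ku have eig: "\<And>x. c (x + u) = z * c x" by (simp only: annihilates_shift_iff)
    with y have z: "z \<noteq> 0" by (rule eigen_nonzero[rotated])
    obtain F j where F: "F \<in> P" and j: "(\<Sum>v\<in>{v\<in>F. row v = j}. z powi pos v) \<noteq> 0"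
      using nonzero_row_sum[OF fin conv prim z] by blast
    \<comment> \<open>\<open>J\<close> shifts all exponents of the transversal translation to be nonnegative.\<close>
    define J where "J = (\<Sum>v\<in>F. \<bar>row v\<bar>)"
    have J: "0 \<le> row v + J" if "v \<in> F" for v
    proof -
      have "\<bar>row v\<bar> \<le> J" unfolding J_def by (rule member_le_sum) (use that fin[OF F] in auto)
      then show ?thesis by linarith
    qed
    define q where "q = (\<Sum>v\<in>F. monom (z powi pos v) (nat (row v + J)))"
    have "{v \<in> F. row v = j} \<noteq> {}" using j by (metis sum.empty)
    then obtain v0 where v0: "v0 \<in> F" "row v0 = j" by blast
    have "coeff q (nat (j + J)) = (\<Sum>v\<in>F. if row v = j then z powi pos v else 0)"
      unfolding q_def coeff_sum
    proof (rule sum.cong[OF refl])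
      fix v assume "v \<in> F"
      then show "coeff (monom (z powi pos v) (nat (row v + J))) (nat (j + J))
          = (if row v = j then z powi pos v else 0)"
        using J[of v] J[of v0] v0 by auto
    qed
    also have "\<dots> = (\<Sum>v\<in>{v\<in>F. row v = j}. z powi pos v)"
      using fin[OF F] by (simp add: sum.If_cases Int_def)
    finally have "q \<noteq> 0" using j by auto
    have "act (poly_at w q) c x = 0" for x
    proof -
      have "act (poly_at w q) c x = (\<Sum>v\<in>F. z powi pos v * c (x + zscale (row v + J) w))"
        unfolding q_def poly_at_sum poly_at_monom act_sum act_single
        by (rule sum.cong) (use J in auto)
      also have "\<dots> = (\<Sum>v\<in>F. c (x + zscale J w + v))"
      proof (rule sum.cong[OF refl])
        fix v
        have "x + zscale (row v + J) w + zscale (pos v) u = x + zscale J w + (zscale (pos v) u + zscale (row v) w)"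
          by (simp add: zscale_add_left algebra_simps)
        also have "\<dots> = x + zscale J w + v" by (simp only: decomp[symmetric])
        finally show "z powi pos v * c (x + zscale (row v + J) w) = c (x + zscale J w + v)"
          using eigen_powi[of c u z "x + zscale (row v + J) w" "pos v", OF eig z] by (simp only:)
      qed
      also have "\<dots> = act (figure_op F) c (x + zscale J w)" by (simp add: act_figure_op)
      also have "\<dots> = 0" using kP F by (simp add: annihilates_def)
      finally show ?thesis .
    qed
    then have "annihilates (poly_at w q) c" by (simp add: annihilates_def fun_eq_iff)
    moreover have "forces {Poly_Mapping.single u 1 - Poly_Mapping.single 0 z} e (poly_at w q)"
      using \<open>q \<noteq> 0\<close> decomp[of e] by (intro forces_poly_at forces_shift)
    ultimately show ?thesis using ku by (simp add: forces_def)
  qed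
qed

end

text \<open>Write \<open>v\<close> as \<open>g\<close> times a primitive \<open>u\<close>; then
  \<open>T v - 1\<close> is the nonzero polynomial \<open>X ^ g - 1\<close> at
  \<open>T u\<close>.\<close>

lemma forces_shift_minus_one:
  assumes fin: "\<And>F. F \<in> P \<Longrightarrow> finite F" and conv: "convex_pattern P"
    and prim: "relatively_prime_pattern P" and v: "v \<noteq> 0"
  shows "forces (figure_op ` P) e (Poly_Mapping.single v 1 - 1)"
proof -
  define g where "g = gcd (fst v) (snd v)"
  have g: "g > 0" using v by (simp add: g_def zero_prod_def prod_eq_iff)
  obtain x y where xy: "x * fst v + y * snd v = g" using bezout_int g_def by metis
  define u where "u = (fst v div g, snd v div g)"
  have vu: "v = zscale g u" by (simp add: u_def zscale_def g_def)
  have "g * (fst u * x + snd u * y) = g * 1"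
    using xy by (subst (asm) (1 2) vu) (simp add: algebra_simps)
  then have "fst u * x - snd u * - y = 1" using g by (simp only: mult_cancel_left) auto
  \<comment> \<open>Bezout's coefficients complete \<open>u\<close> to a lattice basis of
    determinant 1.\<close>
  then interpret unimodular u "(- y, x)" by unfold_locales simp
  have "u_relatively_prime u P" using prim u_nonzero unfolding relatively_prime_pattern_def by blast
  moreover have "monom 1 (nat g) - 1 \<noteq> (0 :: complex poly)"
    using g by (metis degree_1 degree_monom_eq eq_iff_diff_eq_0 less_numeral_extra(3) zero_less_nat_eq zero_neq_one)
  ultimately have "forces (figure_op ` P) e (poly_at u (monom 1 (nat g) - 1))"
    by (intro forces_poly_at forces_primitive fin conv)
  moreover have "poly_at u (monom 1 (nat g) - 1) = Poly_Mapping.single v 1 - 1"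
    using g by (simp add: poly_at_diff poly_at_monom vu)
  ultimately show ?thesis by simp
qed

section \<open>Periodicity of finite-valued recurrent functions\<close>

text \<open>The leading coefficient is nonzero, so \<open>d\<close> consecutive values determine all
  later ones along a line. The number \<open>K\<close> of possible windows of length
  \<open>d\<close> does not depend on the starting point, so one period serves every line.\<close>

lemma recurrent_along_periodic:
  fixes c :: "int \<times> int \<Rightarrow> complex"
  assumes "recurrent_along e c" and fin: "finite A" and range: "\<And>x. c x \<in> A"
  obtains N :: nat where "N > 0" "\<And>x. c (x + zscale (int N) e) = c x"
proof -
  from assms(1) obtain p where p: "p \<noteq> 0" and k: "annihilates (poly_at e p) c" by (auto simp: recurrent_along_def)
  define d where "d = degree p"
  have rel: "(\<Sum>i<d. coeff p i * c (x + zscale (int i) e)) + coeff p d * c (x + zscale (int d) e) = 0" for x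
  proof -
    have "act (poly_at e p) c x = 0" using k by (simp add: annihilates_def)
    then show ?thesis by (simp add: poly_at_def act_sum act_add d_def flip: lessThan_Suc_atMost)
  qed
  define S where "S x y \<longleftrightarrow> (\<forall>i<d. c (x + zscale (int i) e) = c (y + zscale (int i) e))" for x y
  have S_le: "c (x + zscale (int i) e) = c (y + zscale (int i) e)" if "S x y" "i \<le> d" for x y i
  proof (cases "i = d")
    case True
    have "coeff p d * c (x + zscale (int d) e) = coeff p d * c (y + zscale (int d) e)"
      using rel[of x] rel[of y] that(1) by (simp add: S_def add_eq_0_iff)
    then show ?thesis using p True by (simp add: d_def)
  qed (use that in \<open>auto simp: S_def\<close>)
  have S_0: "c x = c y" if "S x y" for x y
    using S_le[OF that, of 0] by simp
  have S_step: "S (x + e) (y + e)" if "S x y" for x y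
    unfolding S_def
  proof (intro allI impI)
    fix i assume "i < d"
    moreover have "z + e + zscale (int i) e = z + zscale (int (Suc i)) e" for z
      by (simp add: zscale_add_left add.assoc)
    ultimately show "c (x + e + zscale (int i) e) = c (y + e + zscale (int i) e)"
      using S_le[OF that, of "Suc i"] by (simp only: Suc_leI)
  qed
  have S_iter: "S (x + zscale (int n) e) (y + zscale (int n) e)" if "S x y" for x y n
  proof (induction n)
    case (Suc n)
    have "z + zscale (int (Suc n)) e = z + zscale (int n) e + e" for z
      by (simp add: zscale_add_left algebra_simps)
    then show ?case using S_step[OF Suc] by (simp only:)
  qed (use that in simp)
  define B where "B = {xs. set xs \<subseteq> A \<and> length xs = d}"
  define K where "K = card B"
  have "finite B" unfolding B_def using fin by (rule finite_lists_length_eq)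
  have ret: "\<exists>k\<in>{1..K}. S x (x + zscale (int k) e)" for x
  proof -
    \<comment> \<open>The recurrence need not run backwards. So a repetition is sought in the
      \<open>K\<close> steps before \<open>x\<close> and carried forward until its first window
      starts at \<open>x\<close>, which gives pure periodicity.\<close>
    define s where "s i = map (\<lambda>l. c (x + zscale (int i - int K) e + zscale (int l) e)) [0..<d]" for i
    have "s ` {..K} \<subseteq> B" by (auto simp: s_def B_def range)
    then have "card (s ` {..K}) \<le> K" unfolding K_def by (rule card_mono[OF \<open>finite B\<close>])
    then have "\<not> inj_on s {..K}" by (intro pigeonhole) simp
    then obtain i j where ij: "i < j" "j \<le> K" "s i = s j"
      unfolding inj_on_def by (metis atMost_iff linorder_neqE_nat)
    have "S (x + zscale (int i - int K) e) (x + zscale (int j - int K) e)"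
      using ij(3) by (simp add: S_def s_def)
    from S_iter[OF this, of "K - i"]
    have "S (x + zscale (int i - int K) e + zscale (int K - int i) e) (x + zscale (int j - int K) e + zscale (int K - int i) e)"
      using ij by (simp add: of_nat_diff)
    moreover have "x + zscale (int i - int K) e + zscale (int K - int i) e = x"
      by (simp add: zscale_diff_left)
    moreover have "x + zscale (int j - int K) e + zscale (int K - int i) e = x + zscale (int (j - i)) e"
      using ij by (simp add: zscale_diff_left of_nat_diff algebra_simps)
    ultimately have "S x (x + zscale (int (j - i)) e)" by (simp only:)
    then show ?thesis using ij by (intro bexI[of _ "j - i"]) auto
  qed
  \<comment> \<open>\<open>fact K\<close> is a multiple of every return time \<open>k\<close> from 1
    to \<open>K\<close>.\<close>
  have "c (x + zscale (int (fact K)) e) = c x" for x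
  proof -
    obtain k where k: "k \<in> {1..K}" "S x (x + zscale (int k) e)" using ret by blast
    have per: "c (x + zscale (int (m * k)) e) = c x" for m
    proof (induction m)
      case (Suc m)
      have "c (x + zscale (int (m * k)) e) = c (x + zscale (int k) e + zscale (int (m * k)) e)"
        using S_iter[OF k(2)] by (rule S_0)
      with Suc show ?case by (simp add: zscale_add_left algebra_simps)
    qed simp
    have "k dvd fact K" using k(1) by (simp add: dvd_fact)
    then obtain m where m: "fact K = k * m" ..
    show ?thesis using per[of m] by (simp add: m mult.commute)
  qed
  then show ?thesis by (intro that[of "fact K"]) auto
qed

section \<open>Dilations of an annihilating figure\<close>

text \<open>The coordinate at \<open>d\<close> in a basis of the complex numbers over the rationals
  that contains \<open>d\<close>.\<close>

lemma additive_functional: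
  fixes d :: complex
  assumes "d \<noteq> 0"
  obtains \<phi> :: "complex \<Rightarrow> rat" where "\<And>x y. \<phi> (x + y) = \<phi> x + \<phi> y" "\<phi> d = 1"
proof -
  interpret V: vector_space "\<lambda>(q::rat) (z::complex). of_rat q * z"
    by unfold_locales (auto simp: algebra_simps of_rat_add of_rat_mult)
  have ind: "V.independent {d}" using assms by simp
  let ?B = "V.extend_basis {d}"
  have B: "V.independent ?B" "d \<in> ?B"
    using V.independent_extend_basis[OF ind] V.extend_basis_superset[OF ind] by auto
  show ?thesis
  proof (rule that[of "\<lambda>x. V.representation ?B x d"])
    show "V.representation ?B (x + y) d = V.representation ?B x d + V.representation ?B y d" for x y
      using B ind by (simp add: V.representation_add)
    show "V.representation ?B d d = 1" using B by (simp add: V.representation_basis)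
  qed
qed

lemma common_denominator:
  fixes A :: "rat set"
  assumes "finite A"
  obtains N :: nat where "N > 0" "\<And>a. a \<in> A \<Longrightarrow> of_nat N * a \<in> \<int>"
  using assms
proof (induction A arbitrary: thesis)
  case empty
  show ?case by (rule empty[of 1]) auto
next
  case (insert a A)
  obtain N where N: "N > 0" "\<And>a. a \<in> A \<Longrightarrow> of_nat N * a \<in> \<int>" using insert.IH by blast
  obtain m n where q: "quotient_of a = (m, n)" by fastforce
  then have n: "n > 0" and a: "a = of_int m / of_int n"
    using quotient_of_denom_pos quotient_of_div by blast+
  show ?case
  proof (rule insert.prems[of "nat n * N"])
    show "nat n * N > 0" using n N by simp
    have na: "of_nat (nat n) * a = of_int m" using n by (simp add: a)
    fix b assume "b \<in> insert a A"
    then consider "b = a" | "b \<in> A" by blast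
    then show "of_nat (nat n * N) * b \<in> \<int>"
    proof cases
      case 1
      have "of_nat (nat n * N) * a = of_nat N * (of_nat (nat n) * a)" by simp
      also have "\<dots> \<in> \<int>" unfolding na by simp
      finally show ?thesis using 1 by simp
    next
      case 2
      have "of_nat (nat n * N) * b = of_nat (nat n) * (of_nat N * b)" by simp
      also have "\<dots> \<in> \<int>" by (rule Ints_mult[OF Ints_of_nat N(2)[OF 2]])
      finally show ?thesis .
    qed
  qed
qed

text \<open>The values of the word are arbitrary complex numbers; clearing denominators turns
  divisibility by a prime into a statement about integers, while \<open>d\<close> still goes to a
  nonzero integer.\<close>

lemma integral_functional:
  fixes d :: complex
  assumes "d \<noteq> 0" "finite A"
  obtains \<psi> :: "complex \<Rightarrow> rat" and N :: nat
  where "Modules.additive \<psi>" "\<And>a. a \<in> A \<Longrightarrow> \<psi> a \<in> \<int>" "N > 0" "\<psi> d = of_nat N"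
proof -
  obtain \<phi> :: "complex \<Rightarrow> rat" where \<phi>: "\<And>x y. \<phi> (x + y) = \<phi> x + \<phi> y" "\<phi> d = 1"
    using additive_functional[OF assms(1)] by metis
  obtain N :: nat where N: "N > 0" "\<And>a. a \<in> \<phi> ` A \<Longrightarrow> of_nat N * a \<in> \<int>"
    using common_denominator[of "\<phi> ` A"] assms(2) by blast
  show ?thesis
  proof (rule that[of "\<lambda>x. of_nat N * \<phi> x" N])
    show "Modules.additive (\<lambda>x. of_nat N * \<phi> x)"
      by (simp add: Modules.additive_def \<phi>(1) algebra_simps)
  qed (use N \<phi>(2) in simp_all)
qed

text \<open>A prime divides the inner binomial coefficients. Membership of \<open>h\<close> in
  \<open>S\<close> is the substance: where \<open>p\<close> is invertible, every element is a
  multiple of \<open>p\<close>.\<close>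

lemma binomial_prime:
  fixes x y :: "'a::comm_ring_1"
  assumes p: "prime p" and S: "1 \<in> S" "0 \<in> S" "\<And>a b. a \<in> S \<Longrightarrow> b \<in> S \<Longrightarrow> a + b \<in> S"
    "\<And>a b. a \<in> S \<Longrightarrow> b \<in> S \<Longrightarrow> a * b \<in> S" and xy: "x \<in> S" "y \<in> S"
  shows "\<exists>h\<in>S. (x + y) ^ p = x ^ p + y ^ p + of_nat p * h"
proof -
  have p0: "p > 0" using p by (rule prime_gt_0_nat)
  have pow: "a ^ n \<in> S" if "a \<in> S" for a n by (induction n) (use S that in auto)
  have nat: "of_nat n \<in> S" for n by (induction n) (use S in auto)
  have sum: "sum f I \<in> S" if "\<And>i. i \<in> I \<Longrightarrow> f i \<in> S" for f :: "nat \<Rightarrow> 'a" and I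
    using that by (induction I rule: infinite_finite_induct) (use S in auto)
  define h where "h = (\<Sum>k\<in>{0<..<p}. of_nat ((p choose k) div p) * x ^ k * y ^ (p - k))"
  have "(x + y) ^ p = (\<Sum>k\<in>{0, p} \<union> {0<..<p}. of_nat (p choose k) * x ^ k * y ^ (p - k))"
    unfolding binomial_ring by (rule sum.cong) auto
  also have "\<dots> = x ^ p + y ^ p + (\<Sum>k\<in>{0<..<p}. of_nat (p choose k) * x ^ k * y ^ (p - k))"
    using p0 by (subst sum.union_disjoint) auto
  also have "(\<Sum>k\<in>{0<..<p}. of_nat (p choose k) * x ^ k * y ^ (p - k)) = of_nat p * h"
    unfolding h_def sum_distrib_left
  proof (rule sum.cong[OF refl])
    fix k assume "k \<in> {0<..<p}"
    then have "p dvd (p choose k)" using p by (intro dvd_choose_prime) auto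
    then have "p choose k = p * ((p choose k) div p)" by simp
    then have "of_nat (p choose k) = (of_nat p * of_nat ((p choose k) div p) :: 'a)"
      by (metis of_nat_mult)
    then show "of_nat (p choose k) * x ^ k * y ^ (p - k)
        = of_nat p * (of_nat ((p choose k) div p) * x ^ k * y ^ (p - k))" by (simp add: mult.assoc)
  qed
  finally have "(x + y) ^ p = x ^ p + y ^ p + of_nat p * h" .
  moreover have "h \<in> S" unfolding h_def using S(4) pow nat xy by (intro sum) auto
  ultimately show ?thesis by blast
qed

lemma sum_power_prime:
  fixes a :: "'i \<Rightarrow> 'a::comm_ring_1"
  assumes p: "prime p" and S: "1 \<in> S" "0 \<in> S" "\<And>a b. a \<in> S \<Longrightarrow> b \<in> S \<Longrightarrow> a + b \<in> S"
    "\<And>a b. a \<in> S \<Longrightarrow> b \<in> S \<Longrightarrow> a * b \<in> S" and a: "\<And>v. v \<in> F \<Longrightarrow> a v \<in> S" and "finite F"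
  shows "\<exists>h\<in>S. (\<Sum>v\<in>F. a v) ^ p = (\<Sum>v\<in>F. a v ^ p) + of_nat p * h"
  using \<open>finite F\<close> a
proof (induction F)
  case empty
  then show ?case using S(2) prime_gt_0_nat[OF p] by (intro bexI[of _ 0]) (auto simp: power_0_left)
next
  case (insert u F)
  then obtain h where h: "h \<in> S" "(\<Sum>v\<in>F. a v) ^ p = (\<Sum>v\<in>F. a v ^ p) + of_nat p * h" by auto
  have "sum a F \<in> S" using insert.hyps(1) insert.prems
    by (induction F) (use S in auto)
  moreover have "a u \<in> S" using insert.prems by simp
  ultimately obtain h' where h': "h' \<in> S" "(a u + sum a F) ^ p = a u ^ p + sum a F ^ p + of_nat p * h'"
    using binomial_prime[OF p S] by blast
  show ?case
    by (rule bexI[of _ "h + h'"]) (use insert.hyps h h' S(3) in \<open>auto simp: algebra_simps\<close>)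
qed

text \<open>Plays the part of the group ring with integer coefficients: closed under sums and
  products and containing all translations, it holds the cofactor \<open>h\<close> of the
  congruence.\<close>

definition integral_ops :: "(complex \<Rightarrow> rat) \<Rightarrow> grp_ring set" where
  "integral_ops \<psi> = {f. \<forall>g. (\<forall>x. \<psi> (g x) \<in> \<int>) \<longrightarrow> (\<forall>x. \<psi> (act f g x) \<in> \<int>)}"

lemma integral_ops:
  assumes "Modules.additive \<psi>"
  shows "1 \<in> integral_ops \<psi>" "0 \<in> integral_ops \<psi>"
    "f \<in> integral_ops \<psi> \<Longrightarrow> g \<in> integral_ops \<psi> \<Longrightarrow> f + g \<in> integral_ops \<psi>"
    "f \<in> integral_ops \<psi> \<Longrightarrow> g \<in> integral_ops \<psi> \<Longrightarrow> f * g \<in> integral_ops \<psi>"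
    "Poly_Mapping.single v 1 \<in> integral_ops \<psi>"
  unfolding integral_ops_def
  by (simp_all add: additive.add[OF assms] additive.zero[OF assms] act_add act_mult del: split_paired_All)

definition dilated :: "(int \<times> int) set \<Rightarrow> nat \<Rightarrow> grp_ring" where
  "dilated F n = (\<Sum>v\<in>F. Poly_Mapping.single (zscale (int n) v) 1)"

lemma act_dilated: "act (dilated F n) c x = (\<Sum>v\<in>F. c (x + zscale (int n) v))"
  by (simp add: dilated_def act_sum)

lemma single_power: "Poly_Mapping.single v (1::complex) ^ n = Poly_Mapping.single (zscale (int n) v) 1"
  by (induction n) (auto simp: mult_single zscale_add_left)

text \<open>If \<open>dilated F n\<close> kills \<open>c\<close>, so does its \<open>p\<close>-th
  power, which is \<open>dilated F (p * n)\<close> plus \<open>p\<close> times an integral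
  \<open>h\<close>. A value \<open>d\<close> would thus be minus \<open>p\<close> times a value of
  \<open>act h c\<close>, and \<open>\<psi>\<close> turns this into \<open>p dvd N\<close>. The
  bound depends on \<open>d\<close> but not on \<open>n\<close> or \<open>x\<close>.\<close>

lemma dilated_avoids_value:
  assumes "finite A" "\<And>x. c x \<in> A" "finite F" "d \<noteq> 0"
  shows "eventually (\<lambda>p. prime p \<longrightarrow>
           (\<forall>n x. annihilates (dilated F n) c \<longrightarrow> act (dilated F (p * n)) c x \<noteq> d)) sequentially"
proof -
  obtain \<psi> :: "complex \<Rightarrow> rat" and N where \<psi>: "Modules.additive \<psi>" "\<And>a. a \<in> A \<Longrightarrow> \<psi> a \<in> \<int>" and N: "N > 0" "\<psi> d = of_nat N"
    using integral_functional[OF \<open>d \<noteq> 0\<close> \<open>finite A\<close>] by metis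
  have \<psi>_mult: "\<psi> (of_nat n * x) = of_nat n * \<psi> x" for n x
    by (induction n) (auto simp: additive.add[OF \<psi>(1)] additive.zero[OF \<psi>(1)] algebra_simps)
  show ?thesis
    unfolding eventually_sequentially
  proof (intro exI[of _ "Suc N"] allI impI notI)
    fix p n x
    assume "Suc N \<le> p" and p: "prime p" and k: "annihilates (dilated F n) c"
      and d: "act (dilated F (p * n)) c x = d"
    obtain h where h: "h \<in> integral_ops \<psi>"
      "dilated F n ^ p = (\<Sum>v\<in>F. Poly_Mapping.single (zscale (int n) v) 1 ^ p) + of_nat p * h"
      unfolding dilated_def
      using sum_power_prime[OF p integral_ops(1-4)[OF \<psi>(1)], of F "\<lambda>v. Poly_Mapping.single (zscale (int n) v) 1"]
        integral_ops(5)[OF \<psi>(1)] \<open>finite F\<close> by blast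
    have eq: "dilated F n ^ p = dilated F (p * n) + of_nat p * h"
      unfolding h(2) by (simp add: dilated_def single_power)
    have "annihilates (dilated F n ^ p) c"
      using k prime_gt_0_nat[OF p] by (elim annihilates_dvd) (simp add: dvd_power)
    then have "act (dilated F (p * n)) c x + act (of_nat p * h) c x = 0"
      by (simp add: eq annihilates_def flip: act_add)
    moreover have "act (of_nat p * h) c x = of_nat p * act h c x"
      unfolding act_mult by (simp flip: single_of_nat)
    ultimately have "d = - (of_nat p * act h c x)" using d by (simp add: eq_neg_iff_add_eq_0)
    then have "of_nat N = - (of_nat p * \<psi> (act h c x))"
      using N by (simp add: additive.minus[OF \<psi>(1)] \<psi>_mult)
    moreover have "\<psi> (act h c x) \<in> \<int>"
      using h(1) \<psi>(2)[OF assms(2)] unfolding integral_ops_def by blast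
    then obtain m where "\<psi> (act h c x) = of_int m" by (elim Ints_cases)
    ultimately have "(of_int (int N) :: rat) = of_int (- (int p * m))" by simp
    then have "int N = - (int p * m)" by (simp only: of_int_eq_iff)
    then have "int p dvd int N" by simp
    then have "p \<le> N" using N(1) by (intro dvd_imp_le) auto
    with \<open>Suc N \<le> p\<close> show False by simp
  qed
qed

text \<open>The dilated sums take values in one finite set, so a single bound \<open>M\<close>
  excludes all nonzero values at once. Multiplying primes of size at least \<open>M\<close> then
  reaches every positive \<open>n\<close> without smaller prime factors.\<close>

lemma dilation:
  assumes A: "finite A" "\<And>x. c x \<in> A" and F: "finite F" and k: "annihilates (dilated F 1) c"
  shows "\<exists>r>0. \<forall>j. annihilates (dilated F (1 + r * j)) c"
proof -
  define D where "D = (\<lambda>a. \<Sum>v\<in>F. a v) ` PiE F (\<lambda>_. A)"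
  have "finite D" unfolding D_def using A F by (intro finite_imageI finite_PiE) auto
  have inD: "act (dilated F n) c x \<in> D" for n x
    unfolding D_def act_dilated
    by (rule image_eqI[of _ _ "restrict (\<lambda>v. c (x + zscale (int n) v)) F"]) (use A in auto)
  have "eventually (\<lambda>p. \<forall>d\<in>D - {0}. prime p \<longrightarrow>
      (\<forall>n x. annihilates (dilated F n) c \<longrightarrow> act (dilated F (p * n)) c x \<noteq> d)) sequentially"
    using \<open>finite D\<close> by (intro eventually_ball_finite ballI dilated_avoids_value[OF A F]) auto
  then obtain M where M: "\<And>p d n x. M \<le> p \<Longrightarrow> d \<in> D \<Longrightarrow> d \<noteq> 0 \<Longrightarrow> prime p \<Longrightarrow>
      annihilates (dilated F n) c \<Longrightarrow> act (dilated F (p * n)) c x \<noteq> d"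
    unfolding eventually_sequentially by blast
  have step: "annihilates (dilated F (p * n)) c" if "M \<le> p" "prime p" "annihilates (dilated F n) c" for p n
    unfolding annihilates_def using M[OF that(1) inD _ that(2,3)] by blast
  have all: "annihilates (dilated F n) c" if "n > 0" "\<And>p. prime p \<Longrightarrow> p dvd n \<Longrightarrow> M \<le> p" for n
    using that
  proof (induction n rule: less_induct)
    case (less n)
    show ?case
    proof (cases "n = 1")
      case False
      then obtain p where p: "prime p" "p dvd n" using prime_factor_nat by blast
      then obtain m where m: "n = p * m" by auto
      have "annihilates (dilated F m) c"
        using less.prems m prime_gt_1_nat[OF p(1)] by (intro less.IH) auto
      then show ?thesis unfolding m using less.prems(2)[OF p] p(1) by (intro step)
    qed (use k in simp)
  qed
  show ?thesis
  \<comment> \<open>A prime below \<open>M\<close> divides \<open>fact M\<close>, so it cannot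
    divide \<open>1 + fact M * j\<close>.\<close>
  proof (intro exI[of _ "fact M"] conjI allI)
    fix j
    show "annihilates (dilated F (1 + fact M * j)) c"
    proof (rule all)
      fix p :: nat assume p: "prime p" "p dvd 1 + fact M * j"
      show "M \<le> p"
      proof (rule ccontr)
        assume "\<not> M \<le> p"
        then have "p dvd fact M" using p(1) by (simp add: prime_dvd_fact_iff)
        then have "p dvd 1" using p(2) dvd_diff_nat[of p "1 + fact M * j" "fact M * j"] by simp
        then show False using p(1) by simp
      qed
    qed simp
  qed simp
qed

section \<open>Averaging over dilations\<close>

lemma act_bounded:
  assumes "\<And>x. norm (c x) \<le> M"
  shows "\<exists>B. \<forall>x. norm (act g c x) \<le> B"
proof (intro exI allI)
  fix x
  show "norm (act g c x) \<le> (\<Sum>v\<in>Poly_Mapping.keys g. norm (Poly_Mapping.lookup g v) * M)"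
    unfolding act_def
    by (rule order.trans[OF norm_sum sum_mono]) (auto simp: norm_mult intro!: mult_left_mono assms)
qed

text \<open>
  Writing \<open>b\<close> for the image of \<open>c\<close> under the product, each summand of the averaged relation for \<open>b\<close>
  telescopes because \<open>T (r v) - 1\<close> is a factor of the product, so \<open>n * b x\<close> stays bounded in \<open>n\<close>.
\<close>

lemma averaging:
  assumes bdd: "\<And>x. norm (c x) \<le> M" and F: "finite F" "0 \<in> F"
    and k: "\<And>j. annihilates (dilated F (1 + r * j)) c"
  shows "annihilates (\<Prod>v\<in>F - {0}. Poly_Mapping.single (zscale (int r) v) 1 - 1) c"
proof -
  define S where "S = F - {0}"
  have S: "finite S" "F = insert 0 S" "0 \<notin> S" using F by (auto simp: S_def)
  define D :: "int \<times> int \<Rightarrow> grp_ring" where "D v = Poly_Mapping.single (zscale (int r) v) 1 - 1" for v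
  define b where "b = act (\<Prod>v\<in>S. D v) c"
  define h where "h v = act (\<Prod>u\<in>S - {v}. D u) c" for v
  have bh: "b x = h v (x + zscale (int r) v) - h v x" if "v \<in> S" for v x
    unfolding b_def h_def prod.remove[OF S(1) that] act_mult by (simp add: D_def act_diff)
  have "\<exists>B. \<forall>x. norm (h v x) \<le> B" for v
    unfolding h_def using bdd by (rule act_bounded)
  then have "\<forall>v. \<exists>B. \<forall>x. norm (h v x) \<le> B" by blast
  then obtain B where "\<forall>v x. norm (h v x) \<le> B v" unfolding choice_iff by blast
  then have B: "norm (h v x) \<le> B v" for v x by blast
  \<comment> \<open>The origin is fixed by every dilation and contributes \<open>b x\<close> for
    each \<open>j\<close>.\<close>
  have rel: "b x + (\<Sum>v\<in>S. h v (x + zscale (1 + int r * int (Suc j)) v) - h v (x + zscale (1 + int r * int j) v)) = 0"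
    for x j
  proof -
    have "annihilates (dilated F (1 + r * j)) b" unfolding b_def using k by (rule annihilates_act)
    then have "act (dilated F (1 + r * j)) b x = 0" by (simp add: annihilates_def)
    then have "b x + (\<Sum>v\<in>S. b (x + zscale (1 + int r * int j) v)) = 0"
      unfolding act_dilated S(2) using S by simp
    moreover have "b (x + zscale (1 + int r * int j) v)
        = h v (x + zscale (1 + int r * int (Suc j)) v) - h v (x + zscale (1 + int r * int j) v)" if "v \<in> S" for v
      unfolding bh[OF that] by (simp add: zscale_add_left algebra_simps)
    ultimately show ?thesis by simp
  qed
  have "b x = 0" for x
  proof (rule ccontr)
    assume "b x \<noteq> 0"
    have bound: "real n * norm (b x) \<le> (\<Sum>v\<in>S. 2 * B v)" for n
    proof -
      have tel: "(\<Sum>j<n. h v (x + zscale (1 + int r * int (Suc j)) v) - h v (x + zscale (1 + int r * int j) v))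
          = h v (x + zscale (1 + int r * int n) v) - h v (x + zscale 1 v)" for v
        using sum_lessThan_telescope[of "\<lambda>j. h v (x + zscale (1 + int r * int j) v)" n] by simp
      have "(\<Sum>j<n. b x + (\<Sum>v\<in>S. h v (x + zscale (1 + int r * int (Suc j)) v) - h v (x + zscale (1 + int r * int j) v))) = 0"
        by (simp only: rel sum.neutral_const)
      then have "of_nat n * b x + (\<Sum>v\<in>S. \<Sum>j<n. h v (x + zscale (1 + int r * int (Suc j)) v) - h v (x + zscale (1 + int r * int j) v)) = 0"
        by (simp only: sum.distrib sum.swap[of _ S] sum_constant card_lessThan)
      then have "of_nat n * b x = - (\<Sum>v\<in>S. h v (x + zscale (1 + int r * int n) v) - h v (x + zscale 1 v))"
        unfolding tel by (simp add: eq_neg_iff_add_eq_0)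
      then have "real n * norm (b x) = norm (\<Sum>v\<in>S. h v (x + zscale (1 + int r * int n) v) - h v (x + zscale 1 v))"
        by (metis norm_minus_cancel norm_mult norm_of_nat)
      also have "\<dots> \<le> (\<Sum>v\<in>S. 2 * B v)"
      proof (rule order.trans[OF norm_sum sum_mono])
        fix v
        show "norm (h v (x + zscale (1 + int r * int n) v) - h v (x + zscale 1 v)) \<le> 2 * B v"
          using norm_triangle_ineq4[of "h v (x + zscale (1 + int r * int n) v)" "h v (x + zscale 1 v)"]
            B[of v "x + zscale (1 + int r * int n) v"] B[of v "x + zscale 1 v"] by linarith
      qed
      finally show ?thesis .
    qed
    obtain n where "(\<Sum>v\<in>S. 2 * B v) < real n * norm (b x)"
      using reals_Archimedean3[of "norm (b x)"] \<open>b x \<noteq> 0\<close> by auto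
    with bound[of n] show False by simp
  qed
  then show ?thesis unfolding annihilates_def b_def D_def S_def by auto
qed

theorem theorem5:
  fixes A :: "complex set"
    and P :: "(int \<times> int) set set"
    and w :: "int \<times> int \<Rightarrow> complex"
    and C :: complex
  assumes "finite A"
    and "is_pattern P"
    and "convex_pattern P"
    and "relatively_prime_pattern P"
    and "\<And>x. w x \<in> A"
    and "\<And>F. F \<in> P \<Longrightarrow> (\<Sum>x\<in>F. w x) = C"
  shows "fully_periodic w"
proof -
  obtain F0 where F0: "finite F0" and P: "P = {(+) v ` F0 | v. True}"
    using assms(2) unfolding is_pattern_def by blast
  have fin: "finite F" if "F \<in> P" for F using that F0 P by auto
  have card: "card F = card F0" if "F \<in> P" for F using that P by (auto simp: card_image)
  have transl: "(+) x ` F \<in> P" if "F \<in> P" for F x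
  proof -
    from that obtain v where "F = (+) v ` F0" using P by auto
    then have "(+) x ` F = (+) (x + v) ` F0" by (auto simp: image_image add.assoc)
    then show ?thesis using P by blast
  qed
  have "F0 \<noteq> {}"
  proof
    assume "F0 = {}"
    then have "P = {{}}" using P by auto
    moreover have "u_relatively_prime (1, 0) P"
      using assms(4) unfolding relatively_prime_pattern_def by (simp add: zero_prod_def)
    ultimately show False by (simp add: u_relatively_prime_def)
  qed
  then obtain v0 where v0: "v0 \<in> F0" by blast
  \<comment> \<open>A translate containing the origin, as averaging requires.\<close>
  define F where "F = (+) (- v0) ` F0"
  have FP: "F \<in> P" using P F_def by blast
  have F: "finite F" "0 \<in> F" using fin[OF FP] v0 unfolding F_def by (auto intro: image_eqI[of _ _ v0])
  \<comment> \<open>Chosen so that the constant word \<open>m\<close> also has sum \<open>C\<close>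
    over each figure; all translates have the same size.\<close>
  define m where "m = C / of_nat (card F0)"
  define c where "c x = w x - m" for x
  have kP: "annihilates (figure_op G) c" if "G \<in> P" for G
  proof -
    have "act (figure_op G) c x = 0" for x
    proof -
      have "act (figure_op G) c x = (\<Sum>v\<in>G. w (x + v)) - of_nat (card G) * m"
        by (simp add: act_figure_op c_def sum_subtractf)
      also have "(\<Sum>v\<in>G. w (x + v)) = (\<Sum>y\<in>(+) x ` G. w y)" by (simp add: sum.reindex)
      also have "\<dots> = C" using transl[OF that] by (rule assms(6))
      finally show ?thesis using \<open>F0 \<noteq> {}\<close> F0 by (simp add: card[OF that] m_def)
    qed
    then show ?thesis by (simp add: annihilates_def fun_eq_iff)
  qed
  define A' where "A' = (\<lambda>a. a - m) ` A"
  have A': "finite A'" "\<And>x. c x \<in> A'" using assms(1,5) by (auto simp: A'_def c_def)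
  have "annihilates (dilated F 1) c" using kP[OF FP] by (simp add: dilated_def figure_op_def)
  from dilation[OF A' F(1) this] obtain r where r: "r > 0" "\<And>j. annihilates (dilated F (1 + r * j)) c"
    by blast
  obtain M where "\<forall>a\<in>A'. norm a \<le> M"
    using A'(1) finite_imp_bounded bounded_iff by metis
  then have "annihilates (\<Prod>v\<in>F - {0}. Poly_Mapping.single (zscale (int r) v) 1 - 1) c"
    using A'(2) by (intro averaging[where M = M] F r) auto
  moreover have "forces (figure_op ` P) e (\<Prod>v\<in>F - {0}. Poly_Mapping.single (zscale (int r) v) 1 - 1)" for e
    using r(1) by (intro forces_prod forces_shift_minus_one fin assms(3,4)) auto
  \<comment> \<open>The annihilating product does not involve \<open>e\<close>, so there are
    recurrences in every direction; the two axes then give independent periods.\<close>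
  ultimately have recurrent_along: "recurrent_along e c" for e using kP unfolding forces_def by blast
  obtain N1 where N1: "N1 > 0" "\<And>x. c (x + zscale (int N1) (1, 0)) = c x"
    using recurrent_along_periodic[OF recurrent_along A'] by blast
  obtain N2 where N2: "N2 > 0" "\<And>x. c (x + zscale (int N2) (0, 1)) = c x"
    using recurrent_along_periodic[OF recurrent_along A'] by blast
  let ?p = "zscale (int N1) (1, 0)" and ?q = "zscale (int N2) (0, 1)"
  have "?p \<noteq> ?q" using N1(1) by (auto simp: zscale_def)
  moreover have "independent {plane_point ?p, plane_point ?q}"
    using N1(1) N2(1)
    by (auto simp: independent_insert span_singleton plane_point_def zero_prod_def)
  moreover have "\<forall>x. w (x + ?p) = w x" using N1(2) by (simp add: c_def)
  moreover have "\<forall>x. w (x + ?q) = w x" using N2(2) by (simp add: c_def)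
  ultimately show ?thesis unfolding fully_periodic_def by blast
qed

end
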